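(* The right restricted HR gradient is consistent with the real gradient in the following sense. Assume $f:H\to H$ admits a power series representation $$f(q) := \sum_{n=-\infty}^{\infty} \tilde q^{\,n}\,a_n\qquad\text{for } R_1\le |\tilde q|\le R_2,$$ with each $a_n$ a quaternion constant, $\tilde q = q-q_0$, and $R_1,R_2>0$ some constants, and let $f'(q):=\sum_{n=-\infty}^{\infty} n\,\tilde q^{\,n-1}a_n$ be the derivative in the usual sense. If $q_0$ is a real number, then $$\frac{\partial^R f(q)}{\partial q}\to f'(q)$$ when $q\to R(q)$, i.e., when $q$ approaches a real number.
   Context: $H$ denotes the non-commutative real algebra of quaternions $q=q_a+q_bi+q_cj+q_dk$ ($q_a,q_b,q_c,q_d\in\mathbb{R}$), with real part $R(q)=q_a$, conjugate $q^*=q_a-q_bi-q_cj-q_dk$ and $|q|^2=qq^*$. A function $f:H\to H$ is viewed as a function of the four real variables $q_a,q_b,q_c,q_d$, with quaternion-valued partial derivatives $\partial f/\partial q_a,\dots,\partial f/\partial q_d$. The right restricted HR derivative of $f$ with respect to $q$ is $$\frac{\partial^R f}{\partial q}:=\frac14\left(\frac{\partial f}{\partial q_a}-i\frac{\partial f}{\partial q_b}-j\frac{\partial f}{\partial q_c}-k\frac{\partial f}{\partial q_d}\right).$$ *)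

theory Defs
  imports "HOL-Analysis.Analysis"
begin

datatype quat = Quat (Qa: real) (Qb: real) (Qc: real) (Qd: real)

lemma quat_eq_iff: "p = q \<longleftrightarrow> Qa p = Qa q \<and> Qb p = Qb q \<and> Qc p = Qc q \<and> Qd p = Qd q"
  by (cases p; cases q) simp

instantiation quat :: ring_1
begin

definition "0 = Quat 0 0 0 0"
definition "1 = Quat 1 0 0 0"
definition "p + q = Quat (Qa p + Qa q) (Qb p + Qb q) (Qc p + Qc q) (Qd p + Qd q)"
definition "- q = Quat (- Qa q) (- Qb q) (- Qc q) (- Qd q)"
definition "p - q = Quat (Qa p - Qa q) (Qb p - Qb q) (Qc p - Qc q) (Qd p - Qd q)"
definition "p * q = Quat
  (Qa p * Qa q - Qb p * Qb q - Qc p * Qc q - Qd p * Qd q)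
  (Qa p * Qb q + Qb p * Qa q + Qc p * Qd q - Qd p * Qc q)
  (Qa p * Qc q - Qb p * Qd q + Qc p * Qa q + Qd p * Qb q)
  (Qa p * Qd q + Qb p * Qc q - Qc p * Qb q + Qd p * Qa q)"

lemmas quat_ring_defs =
  zero_quat_def one_quat_def plus_quat_def uminus_quat_def minus_quat_def times_quat_def

instance
  by standard (simp_all add: quat_ring_defs algebra_simps)

end

instantiation quat :: real_algebra_1
begin

definition "r *\<^sub>R q = Quat (r * Qa q) (r * Qb q) (r * Qc q) (r * Qd q)"

instance
  by standard (simp_all add: quat_ring_defs scaleR_quat_def algebra_simps)

end

definition quat_cnj :: "quat \<Rightarrow> quat" where
  "quat_cnj q = Quat (Qa q) (- Qb q) (- Qc q) (- Qd q)"

instantiation quat :: real_normed_div_algebra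
begin

definition "norm q = sqrt ((Qa q)\<^sup>2 + (Qb q)\<^sup>2 + (Qc q)\<^sup>2 + (Qd q)\<^sup>2)"
definition "inverse q = (1 / (norm q)\<^sup>2) *\<^sub>R quat_cnj q"
definition "p div q = p * inverse q" for p q :: quat
definition "sgn q = q /\<^sub>R norm q" for q :: quat
definition "dist p q = norm (p - q)" for p q :: quat
definition "uniformity = (INF e\<in>{0<..}. principal {(p::quat, q). dist p q < e})"
definition "open U \<longleftrightarrow> (\<forall>p\<in>U. eventually (\<lambda>(p', q). p' = p \<longrightarrow> q \<in> U) uniformity)"
  for U :: "quat set"

lemma norm_quat_squared: "(norm (q::quat))\<^sup>2 = (Qa q)\<^sup>2 + (Qb q)\<^sup>2 + (Qc q)\<^sup>2 + (Qd q)\<^sup>2"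
  by (simp add: norm_quat_def)

lemma norm_quat_eq_0: "norm (q::quat) = 0 \<longleftrightarrow> q = 0"
proof -
  have "norm q = 0 \<longleftrightarrow> (Qa q)\<^sup>2 + (Qb q)\<^sup>2 + (Qc q)\<^sup>2 + (Qd q)\<^sup>2 = 0"
    by (simp add: norm_quat_def)
  also have "\<dots> \<longleftrightarrow> Qa q = 0 \<and> Qb q = 0 \<and> Qc q = 0 \<and> Qd q = 0"
    by (simp add: add_nonneg_eq_0_iff)
  finally show ?thesis
    by (simp add: quat_eq_iff zero_quat_def)
qed

lemma norm_quat_conv_prod:
  "norm (q::quat) = norm ((Qa q, Qb q), (Qc q, Qd q))"
  by (simp add: norm_quat_def norm_Pair)

lemma mult_quat_cnj: "q * quat_cnj q = of_real ((norm q)\<^sup>2)"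
  unfolding norm_quat_squared
  by (simp add: of_real_def scaleR_quat_def quat_ring_defs quat_cnj_def power2_eq_square)

lemma quat_cnj_mult: "quat_cnj q * q = of_real ((norm q)\<^sup>2)"
  unfolding norm_quat_squared
  by (simp add: of_real_def scaleR_quat_def quat_ring_defs quat_cnj_def power2_eq_square)

instance
proof
  fix p q :: quat and r :: real
  show "norm (p + q) \<le> norm p + norm q"
    using norm_triangle_ineq[of "((Qa p, Qb p), (Qc p, Qd p))" "((Qa q, Qb q), (Qc q, Qd q))"]
    by (simp add: norm_quat_conv_prod plus_quat_def)
  have "(norm (r *\<^sub>R q))\<^sup>2 = (\<bar>r\<bar> * norm q)\<^sup>2"
    unfolding power_mult_distrib norm_quat_squared
    by (simp add: scaleR_quat_def power_mult_distrib algebra_simps)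
  then show "norm (r *\<^sub>R q) = \<bar>r\<bar> * norm q"
    by (simp add: norm_quat_def)
  have "(norm (p * q))\<^sup>2 = (norm p * norm q)\<^sup>2"
    unfolding power_mult_distrib norm_quat_squared
    by (simp add: times_quat_def power2_eq_square algebra_simps)
  then show "norm (p * q) = norm p * norm q"
    by (simp add: norm_quat_def)
  show "norm q = 0 \<longleftrightarrow> q = 0"
    by (rule norm_quat_eq_0)
  show "q \<noteq> 0 \<Longrightarrow> inverse q * q = 1" "q \<noteq> 0 \<Longrightarrow> q * inverse q = 1"
    by (simp_all add: inverse_quat_def mult_quat_cnj quat_cnj_mult norm_quat_eq_0 of_real_def)
  show "inverse 0 = (0::quat)"
    by (simp add: inverse_quat_def quat_cnj_def zero_quat_def scaleR_quat_def)
qed (simp_all add: sgn_quat_def dist_quat_def uniformity_quat_def open_quat_def divide_quat_def)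

end

definition qi :: quat where "qi = Quat 0 1 0 0"
definition qj :: quat where "qj = Quat 0 0 1 0"
definition qk :: quat where "qk = Quat 0 0 0 1"

lemma quat_units_mult:
  "qi * qi = -1" "qj * qj = -1" "qk * qk = -1"
  "qi * qj = qk" "qj * qk = qi" "qk * qi = qj"
  "qj * qi = - qk" "qk * qj = - qi" "qi * qk = - qj"
  by (simp_all add: qi_def qj_def qk_def quat_ring_defs)

definition slice_a :: "(quat \<Rightarrow> quat) \<Rightarrow> quat \<Rightarrow> real \<Rightarrow> quat" where
  "slice_a f q t = f (Quat t (Qb q) (Qc q) (Qd q))"
definition slice_b :: "(quat \<Rightarrow> quat) \<Rightarrow> quat \<Rightarrow> real \<Rightarrow> quat" where
  "slice_b f q t = f (Quat (Qa q) t (Qc q) (Qd q))"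
definition slice_c :: "(quat \<Rightarrow> quat) \<Rightarrow> quat \<Rightarrow> real \<Rightarrow> quat" where
  "slice_c f q t = f (Quat (Qa q) (Qb q) t (Qd q))"
definition slice_d :: "(quat \<Rightarrow> quat) \<Rightarrow> quat \<Rightarrow> real \<Rightarrow> quat" where
  "slice_d f q t = f (Quat (Qa q) (Qb q) (Qc q) t)"

definition has_partials_at :: "(quat \<Rightarrow> quat) \<Rightarrow> quat \<Rightarrow> bool" where
  "has_partials_at f q \<longleftrightarrow>
     slice_a f q differentiable (at (Qa q)) \<and> slice_b f q differentiable (at (Qb q)) \<and>
     slice_c f q differentiable (at (Qc q)) \<and> slice_d f q differentiable (at (Qd q))"

text \<open>
  This value is only meaningful where \<open>has_partials_at\<close> holds.
\<close>

definition right_HR_deriv :: "(quat \<Rightarrow> quat) \<Rightarrow> quat \<Rightarrow> quat" where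
  "right_HR_deriv f q = (1/4) *\<^sub>R
     (vector_derivative (slice_a f q) (at (Qa q))
      - qi * vector_derivative (slice_b f q) (at (Qb q))
      - qj * vector_derivative (slice_c f q) (at (Qc q))
      - qk * vector_derivative (slice_d f q) (at (Qd q)))"

text \<open>
  Two-sided series, in the usual sense for Laurent series: the series over \<open>n \<ge> 0\<close> and the series
  over \<open>n < 0\<close> converge separately (not necessarily absolutely).
\<close>

definition bilateral_sums :: "(int \<Rightarrow> 'a::real_normed_vector) \<Rightarrow> 'a \<Rightarrow> bool" where
  "bilateral_sums u s \<longleftrightarrow>
     (\<exists>s1 s2. (\<lambda>n. u (int n)) sums s1 \<and> (\<lambda>n. u (- int (Suc n))) sums s2 \<and> s = s1 + s2)"

definition bilateral_summable :: "(int \<Rightarrow> 'a::real_normed_vector) \<Rightarrow> bool" where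
  "bilateral_summable u \<longleftrightarrow> (\<exists>s. bilateral_sums u s)"

definition bilateral_suminf :: "(int \<Rightarrow> 'a::real_normed_vector) \<Rightarrow> 'a" where
  "bilateral_suminf u = (THE s. bilateral_sums u s)"

definition laurent_deriv_term :: "(int \<Rightarrow> quat) \<Rightarrow> quat \<Rightarrow> quat \<Rightarrow> int \<Rightarrow> quat" where
  "laurent_deriv_term a q0 q n = of_int n * (q - q0) powi (n - 1) * a n"

definition laurent_deriv :: "(int \<Rightarrow> quat) \<Rightarrow> quat \<Rightarrow> quat \<Rightarrow> quat" where
  "laurent_deriv a q0 q = bilateral_suminf (laurent_deriv_term a q0 q)"

end

theory Submission
  imports Defs
begin

text \<open>
  On the open annulus \<open>R1 < \<bar>q - q0\<bar> < R2\<close> the Laurent series may be differentiated term by term.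
  Since quaternions do not commute, the derivative of \<open>u\<^sup>n\<close> in the direction \<open>h\<close> is the sum
  of \<open>u\<^sup>k h u\<^sup>l\<close> over \<open>k + l = n - 1\<close>, of norm at most \<open>n \<bar>u\<bar>\<^sup>n\<^sup>-\<^sup>1 \<bar>h\<bar>\<close>. This is the bound known from
  commutative power series, so \<open>f\<close> is real differentiable (\<open>has_derivative_laurent\<close>) and
  its derivative \<open>F(q) h\<close> is continuous in \<open>q\<close> for each fixed \<open>h\<close>
  (\<open>tendsto_laurent_frechet\<close>). The negative powers need no separate analysis: they form an
  ordinary power series in \<open>inverse (q - q0)\<close>, and the chain rule applies.

  If \<open>h\<close> commutes with \<open>q - q0\<close>, all \<open>n\<close> summands coincide and \<open>F(q) h = h f'(q)\<close>
  (\<open>laurent_frechet_commuting\<close>). For \<open>h = 1\<close> this identifies \<open>f'(q)\<close> with \<open>F(q) 1\<close> at every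
  point of the annulus, so \<open>f'\<close> exists and is continuous there. If \<open>q0\<close> is real and \<open>q = x\<close> is
  real, every \<open>h\<close> commutes with \<open>x - q0\<close>, and the right HR derivative at \<open>x\<close> is
  \<open>(F(x) 1 - i F(x) i - j F(x) j - k F(x) k) / 4 = (1 - i\<^sup>2 - j\<^sup>2 - k\<^sup>2) f'(x) / 4 = f'(x)\<close>.
  Continuity of \<open>F\<close> extends this equality at \<open>x\<close> to the limit \<open>q \<rightarrow> x\<close>.
\<close>

section \<open>Power series with right coefficients in a normed division algebra\<close>

text \<open>
  The derivative of \<open>u \<mapsto> u\<^sup>n\<close> at \<open>u\<close> in direction \<open>h\<close>. For \<open>n = 0\<close> the sum is empty, so the
  truncated exponent \<open>n - 1 - k\<close> is never evaluated below zero.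
\<close>

definition power_deriv :: "nat \<Rightarrow> 'a::real_normed_div_algebra \<Rightarrow> 'a \<Rightarrow> 'a" where
  "power_deriv n u h = (\<Sum>k<n. u ^ k * h * u ^ (n - 1 - k))"

lemma power_deriv_Suc: "power_deriv (Suc n) u h = u * power_deriv n u h + h * u ^ n"
  unfolding power_deriv_def sum.lessThan_Suc_shift
  by (simp add: sum_distrib_left mult.assoc)

lemma has_derivative_power_right:
  fixes u :: "'a::real_normed_div_algebra"
  shows "((\<lambda>u. u ^ n) has_derivative power_deriv n u) (at u within S)"
proof (induction n)
  case 0
  then show ?case by (simp add: power_deriv_def[abs_def])
next
  case (Suc n)
  have "((\<lambda>u. u * u ^ n) has_derivative (\<lambda>h. u * power_deriv n u h + h * u ^ n)) (at u within S)"
    by (rule has_derivative_mult[OF has_derivative_ident Suc.IH])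
  then show ?case
    by (simp add: power_deriv_Suc[abs_def])
qed

lemma norm_power_deriv_le:
  "norm (power_deriv n u h) \<le> real n * norm u ^ (n - 1) * norm h"
proof -
  have "norm (u ^ k * h * u ^ (n - 1 - k)) = norm u ^ (n - 1) * norm h" if "k < n" for k
  proof -
    have "norm u ^ k * norm u ^ (n - 1 - k) = norm u ^ (n - 1)"
      using that by (simp flip: power_add)
    then show ?thesis
      by (simp add: norm_mult norm_power mult_ac)
  qed
  then have "norm (power_deriv n u h) \<le> (\<Sum>k<n. norm u ^ (n - 1) * norm h)"
    unfolding power_deriv_def by (intro sum_norm_le) auto
  then show ?thesis by simp
qed

text \<open>
  When \<open>h\<close> commutes with \<open>u\<close> it can be pulled out to the left of every summand. It is kept on the
  left because the coefficients of the series stand on the right.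
\<close>

lemma power_deriv_commuting:
  assumes "u * h = h * u"
  shows "power_deriv n u h = of_nat n * (h * u ^ (n - 1))"
proof -
  have "u ^ k * h * u ^ (n - 1 - k) = h * u ^ (n - 1)" if "k < n" for k
  proof -
    have "u ^ k * h = h * u ^ k"
      using assms by (rule power_commuting_commutes)
    moreover have "u ^ k * u ^ (n - 1 - k) = u ^ (n - 1)"
      using that by (simp flip: power_add)
    ultimately show ?thesis by (simp add: mult.assoc)
  qed
  then show ?thesis by (simp add: power_deriv_def)
qed

text \<open>
  For a convergent series this is the real derivative of \<open>u \<mapsto> \<Sum>n. u\<^sup>n c\<^sub>n\<close> in direction \<open>h\<close>.
\<close>

definition powser_deriv :: "(nat \<Rightarrow> 'a) \<Rightarrow> 'a \<Rightarrow> 'a \<Rightarrow> 'a::{real_normed_div_algebra,banach}" where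
  "powser_deriv c u h = (\<Sum>n. power_deriv n u h * c n)"

text \<open>
  Convergence at the single point \<open>r\<close> bounds \<open>r\<^sup>n \<bar>c\<^sub>n\<bar>\<close>, so the real power series with
  coefficients \<open>\<bar>c\<^sub>n\<bar>\<close> converges on \<open>(-r, r)\<close> by comparison with a geometric series. The theory of
  commutative power series then provides the convergence of its derived series, which is the
  majorant for everything below.
\<close>

lemma summable_powser_termdiff_norm:
  fixes c :: "nat \<Rightarrow> 'a::{real_normed_div_algebra,banach}" and s r :: real
  assumes "summable (\<lambda>n. of_real r ^ n * c n)" and "0 \<le> s" and "s < r"
  shows "summable (\<lambda>n. real n * s ^ (n - 1) * norm (c n))"
proof -
  have "summable (\<lambda>n. norm (c n) * x ^ n)" if "norm x < r" for x :: real
  proof -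
    have "summable (\<lambda>n. norm (of_real r ^ n * c n) * (x / r) ^ n)"
    proof (rule summable_comparison_test_bigo)
      show "summable (\<lambda>n. norm ((\<bar>x\<bar> / r) ^ n))"
        using that assms by (simp add: summable_geometric)
      have "(\<lambda>n. of_real r ^ n * c n) \<longlonglongrightarrow> 0"
        using assms(1) by (rule summable_LIMSEQ_zero)
      then have "Bseq (\<lambda>n. of_real r ^ n * c n)"
        by (intro convergent_imp_Bseq convergentI)
      then obtain B where "\<And>n. norm (of_real r ^ n * c n) \<le> B"
        by (auto simp: Bseq_def)
      then show "(\<lambda>n. norm (of_real r ^ n * c n) * (x / r) ^ n) \<in> O(\<lambda>n. (\<bar>x\<bar> / r) ^ n)"
        using assms by (intro bigoI[of _ B] always_eventually allI)
          (auto simp: abs_mult power_abs intro!: mult_right_mono)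
    qed
    then show ?thesis
      using assms by (simp add: norm_mult norm_power power_divide mult_ac)
  qed
  then have "summable (\<lambda>n. diffs (\<lambda>n. norm (c n)) n * s ^ n)"
    using assms by (intro termdiff_converges[of s r]) auto
  then have "summable (\<lambda>n. real (Suc n) * s ^ (Suc n - 1) * norm (c (Suc n)))"
    by (simp add: diffs_def mult_ac)
  then show ?thesis
    by (subst (asm) summable_Suc_iff)
qed

lemma norm_powser_deriv_term_le:
  assumes "norm u \<le> s"
  shows "norm (power_deriv n u h * c n) \<le> (real n * s ^ (n - 1) * norm (c n)) * norm h"
proof -
  have "norm (power_deriv n u h * c n) \<le> real n * norm u ^ (n - 1) * norm h * norm (c n)"
    unfolding norm_mult by (intro mult_right_mono norm_power_deriv_le) auto
  also have "\<dots> \<le> real n * s ^ (n - 1) * norm h * norm (c n)"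
    using assms by (intro mult_right_mono mult_left_mono power_mono) auto
  finally show ?thesis by (simp add: mult_ac)
qed

context
  fixes c :: "nat \<Rightarrow> 'a::{real_normed_div_algebra,banach}" and r :: real
  assumes convergent: "summable (\<lambda>n. of_real r ^ n * c n)"
begin

lemma powser_deriv_sums:
  assumes "norm u < r"
  shows "(\<lambda>n. power_deriv n u h * c n) sums powser_deriv c u h"
  unfolding powser_deriv_def
proof (rule summable_sums, rule summable_comparison_test')
  show "summable (\<lambda>n. (real n * norm u ^ (n - 1) * norm (c n)) * norm h)"
    using assms by (intro summable_mult2 summable_powser_termdiff_norm[OF convergent]) auto
qed (rule norm_powser_deriv_term_le, simp)

text \<open>
  A ball of radius \<open>s\<close> strictly between \<open>\<bar>u\<bar>\<close> and \<open>r\<close> is convex, and on it the majorant at \<open>s\<close>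
  makes the tails of the differentiated series uniformly small relative to \<open>\<bar>h\<bar>\<close>, which is what
  termwise differentiation requires.
\<close>

lemma has_derivative_powser:
  assumes "norm u < r"
  shows "((\<lambda>u. \<Sum>n. u ^ n * c n) has_derivative powser_deriv c u) (at u)"
proof -
  obtain s where s: "norm u < s" "s < r"
    using assms dense by blast
  have "0 \<le> s" using s(1) norm_ge_zero[of u] by linarith
  let ?M = "\<lambda>n. real n * s ^ (n - 1) * norm (c n)"
  have M: "summable ?M"
    using \<open>0 \<le> s\<close> s by (intro summable_powser_termdiff_norm[OF convergent])
  have "\<exists>g. \<forall>u\<in>ball 0 s. (\<lambda>n. u ^ n * c n) sums g u \<and>
          (g has_derivative powser_deriv c u) (at u within ball 0 s)"
  proof (rule has_derivative_series)
    show "convex (ball (0::'a) s)" by simp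
    show "((\<lambda>u. u ^ n * c n) has_derivative (\<lambda>h. power_deriv n v h * c n)) (at v within ball 0 s)"
      for n v
      by (rule has_derivative_mult_left[OF has_derivative_power_right])
    show "0 \<in> ball (0::'a) s" using s(1) norm_ge_zero[of u] by (simp del: norm_ge_zero)
    show "(\<lambda>n. 0 ^ n * c n) sums c 0"
      using sums_single[of 0 c] by (rule sums_cong[THEN iffD1, rotated]) (simp add: power_0_left)
    fix e :: real assume "e > 0"
    obtain N where N: "\<And>n. n \<ge> N \<Longrightarrow> norm (\<Sum>i. ?M (i + n)) < e"
      using suminf_exist_split[OF \<open>e > 0\<close> M] by blast
    show "\<forall>\<^sub>F n in sequentially. \<forall>v\<in>ball 0 s. \<forall>h.
            norm ((\<Sum>i<n. power_deriv i v h * c i) - powser_deriv c v h) \<le> e * norm h"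
      unfolding eventually_sequentially
    proof (intro exI[of _ N] allI impI ballI)
      fix n v h assume n: "N \<le> n" and v: "v \<in> ball (0::'a) s"
      let ?T = "\<lambda>i. power_deriv i v h * c i"
      have "summable ?T"
        using powser_deriv_sums[of v h] v s by (auto dest: sums_summable)
      then have "(\<Sum>i<n. ?T i) - powser_deriv c v h = - (\<Sum>i. ?T (i + n))"
        unfolding powser_deriv_def by (subst suminf_minus_initial_segment) auto
      also have "norm \<dots> \<le> (\<Sum>i. ?M (i + n) * norm h)"
        unfolding norm_minus_cancel
      proof (rule norm_suminf_le)
        show "norm (?T (i + n)) \<le> ?M (i + n) * norm h" for i
          using v by (intro norm_powser_deriv_term_le) auto
        show "summable (\<lambda>i. ?M (i + n) * norm h)"
          using M by (intro summable_mult2 summable_ignore_initial_segment)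
      qed
      also have "\<dots> = (\<Sum>i. ?M (i + n)) * norm h"
        using M by (intro suminf_mult2[symmetric] summable_ignore_initial_segment)
      also have "\<dots> \<le> e * norm h"
        using N[OF n] by (intro mult_right_mono) auto
      finally show "norm ((\<Sum>i<n. ?T i) - powser_deriv c v h) \<le> e * norm h" .
    qed
  qed
  then obtain g where g: "\<And>v. v \<in> ball 0 s \<Longrightarrow> (\<lambda>n. v ^ n * c n) sums g v"
      "\<And>v. v \<in> ball 0 s \<Longrightarrow> (g has_derivative powser_deriv c v) (at v within ball 0 s)"
    by blast
  have u: "u \<in> ball 0 s" using s by simp
  have "(g has_derivative powser_deriv c u) (at u)"
    using g(2)[OF u] by (simp only: at_within_open[OF u open_ball])
  then show ?thesis
    by (rule has_derivative_transform_within_open[of _ _ _ _ "ball 0 s"])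
      (use u g(1) in \<open>auto simp: sums_iff\<close>)
qed

text \<open>
  The direction is allowed to vary with the point: for the principal part of a Laurent series the
  chain rule gives the direction \<open>- v h v\<close> with \<open>v = inverse (q - q0)\<close>, which depends on \<open>q\<close>.
  The argument is uniform convergence on a product of balls, the directions having norm at most
  \<open>\<bar>h\<bar> + 1\<close>.
\<close>

lemma tendsto_powser_deriv:
  assumes "norm u < r" and "(g \<longlongrightarrow> u) F" and "(k \<longlongrightarrow> h) F"
  shows "((\<lambda>x. powser_deriv c (g x) (k x)) \<longlongrightarrow> powser_deriv c u h) F"
proof -
  obtain s where s: "norm u < s" "s < r"
    using assms(1) dense by blast
  have "0 \<le> s" using s(1) norm_ge_zero[of u] by linarith
  define U where "U = ball (0::'a) s \<times> ball (0::'a) (norm h + 1)"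
  have "uniform_limit U (\<lambda>n p. \<Sum>i<n. power_deriv i (fst p) (snd p) * c i)
          (\<lambda>p. \<Sum>i. power_deriv i (fst p) (snd p) * c i) sequentially"
  proof (rule Weierstrass_m_test)
    show "summable (\<lambda>n. (real n * s ^ (n - 1) * norm (c n)) * (norm h + 1))"
      using \<open>0 \<le> s\<close> s by (intro summable_mult2 summable_powser_termdiff_norm[OF convergent])
    fix n p assume p: "p \<in> U"
    have "norm (power_deriv n (fst p) (snd p) * c n)
          \<le> (real n * s ^ (n - 1) * norm (c n)) * norm (snd p)"
      using p by (intro norm_powser_deriv_term_le) (auto simp: U_def)
    also have "\<dots> \<le> (real n * s ^ (n - 1) * norm (c n)) * (norm h + 1)"
      using p \<open>0 \<le> s\<close> by (intro mult_left_mono) (auto simp: U_def)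
    finally show "norm (power_deriv n (fst p) (snd p) * c n)
          \<le> (real n * s ^ (n - 1) * norm (c n)) * (norm h + 1)" .
  qed
  then have "continuous_on U (\<lambda>p. powser_deriv c (fst p) (snd p))"
    unfolding powser_deriv_def
    by (rule uniform_limit_theorem[rotated])
      (auto simp: power_deriv_def intro!: always_eventually continuous_intros)
  moreover have "open U" and "(u, h) \<in> U"
    using s by (auto simp: U_def intro!: open_Times)
  ultimately have "isCont (\<lambda>p. powser_deriv c (fst p) (snd p)) (u, h)"
    by (simp add: continuous_on_eq_continuous_at)
  from isCont_tendsto_compose[OF this tendsto_Pair[OF assms(2,3)]] show ?thesis by simp
qed

end

section \<open>Real differentiation of quaternion functions\<close>

lemma bounded_linear_quat_to_prod:
  "bounded_linear (\<lambda>q. ((Qa q, Qb q), (Qc q, Qd q)))"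
  by (rule bounded_linear_intro[where K = 1])
    (simp_all add: norm_quat_conv_prod plus_quat_def scaleR_quat_def)

lemma bounded_linear_prod_to_quat:
  "bounded_linear (\<lambda>p. Quat (fst (fst p)) (snd (fst p)) (fst (snd p)) (snd (snd p)))"
  by (rule bounded_linear_intro[where K = 1])
    (simp_all add: norm_quat_conv_prod plus_quat_def scaleR_quat_def)

text \<open>
  Convergence of absolutely convergent quaternion series rests on completeness, which is inherited
  from the isometric product space of the four real coordinates.
\<close>

instance quat :: banach
proof
  fix X :: "nat \<Rightarrow> quat" assume "Cauchy X"
  then have "Cauchy (\<lambda>n. ((Qa (X n), Qb (X n)), (Qc (X n), Qd (X n))))"
    by (rule bounded_linear.Cauchy[OF bounded_linear_quat_to_prod])
  then obtain l where "(\<lambda>n. ((Qa (X n), Qb (X n)), (Qc (X n), Qd (X n)))) \<longlonglongrightarrow> l"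
    using Cauchy_convergent convergent_def by blast
  from bounded_linear.tendsto[OF bounded_linear_prod_to_quat this] show "convergent X"
    by (auto simp: convergent_def)
qed

text \<open>
  Each slice is \<open>f\<close> along an affine line through \<open>q\<close> in the direction of a quaternion unit, so
  the partial derivatives are values of the real derivative.
\<close>

lemma slice_has_vector_derivative:
  assumes "(f has_derivative D) (at q)"
  shows "(slice_a f q has_vector_derivative D 1) (at (Qa q))"
    and "(slice_b f q has_vector_derivative D qi) (at (Qb q))"
    and "(slice_c f q has_vector_derivative D qj) (at (Qc q))"
    and "(slice_d f q has_vector_derivative D qk) (at (Qd q))"
proof -
  have line: "((\<lambda>t. f (q + (t - t0) *\<^sub>R e)) has_vector_derivative D e) (at t0)" for t0 e
  proof -
    have "((\<lambda>t. q + (t - t0) *\<^sub>R e) has_derivative (\<lambda>t. t *\<^sub>R e)) (at t0)"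
      by (auto intro!: derivative_eq_intros)
    moreover have "(f has_derivative D) (at (q + (t0 - t0) *\<^sub>R e))"
      using assms by simp
    ultimately have "((\<lambda>t. f (q + (t - t0) *\<^sub>R e)) has_derivative (\<lambda>t. D (t *\<^sub>R e))) (at t0)"
      by (rule has_derivative_compose)
    then show ?thesis
      using linear_simps(5)[OF has_derivative_bounded_linear[OF assms]]
      by (simp add: has_vector_derivative_def)
  qed
  have "slice_a f q = (\<lambda>t. f (q + (t - Qa q) *\<^sub>R 1))"
    and "slice_b f q = (\<lambda>t. f (q + (t - Qb q) *\<^sub>R qi))"
    and "slice_c f q = (\<lambda>t. f (q + (t - Qc q) *\<^sub>R qj))"
    and "slice_d f q = (\<lambda>t. f (q + (t - Qd q) *\<^sub>R qk))"
    by (simp_all add: fun_eq_iff slice_a_def slice_b_def slice_c_def slice_d_def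
        plus_quat_def scaleR_quat_def one_quat_def qi_def qj_def qk_def)
  then show "(slice_a f q has_vector_derivative D 1) (at (Qa q))"
    and "(slice_b f q has_vector_derivative D qi) (at (Qb q))"
    and "(slice_c f q has_vector_derivative D qj) (at (Qc q))"
    and "(slice_d f q has_vector_derivative D qk) (at (Qd q))"
    by (simp_all add: line)
qed

lemma has_derivative_imp_has_partials_at:
  assumes "(f has_derivative D) (at q)"
  shows "has_partials_at f q"
  using slice_has_vector_derivative[OF assms]
  unfolding has_partials_at_def by (blast intro: differentiableI_vector)

lemma right_HR_deriv_eq:
  assumes "(f has_derivative D) (at q)"
  shows "right_HR_deriv f q = (1/4) *\<^sub>R (D 1 - qi * D qi - qj * D qj - qk * D qk)"
  using slice_has_vector_derivative[OF assms]
  by (simp add: right_HR_deriv_def vector_derivative_at)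

section \<open>Laurent series\<close>

lemma bilateral_suminf_eqI:
  assumes "bilateral_sums u s"
  shows "bilateral_suminf u = s"
  unfolding bilateral_suminf_def
  using assms by (rule the_equality) (metis assms bilateral_sums_def sums_unique2)

text \<open>
  Coefficients of the principal part read as a power series in \<open>inverse w\<close>. The constant
  coefficient is \<open>0\<close>, because \<open>a 0\<close> already belongs to the regular part.
\<close>

definition principal_coeff :: "(int \<Rightarrow> quat) \<Rightarrow> nat \<Rightarrow> quat" where
  "principal_coeff a n = (if n = 0 then 0 else a (- int n))"

text \<open>
  The real derivative of \<open>\<Sum>n. w\<^sup>n a\<^sub>n\<close> in direction \<open>h\<close>. The second summand is the chain rule
  for the substitution \<open>w \<mapsto> inverse w\<close>, whose derivative is \<open>h \<mapsto> - inverse w * h * inverse w\<close>.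
\<close>

definition laurent_frechet :: "(int \<Rightarrow> quat) \<Rightarrow> quat \<Rightarrow> quat \<Rightarrow> quat" where
  "laurent_frechet a w h = powser_deriv (\<lambda>n. a (int n)) w h
     + powser_deriv (principal_coeff a) (inverse w) (- (inverse w * h * inverse w))"

lemma bilateral_sums_imp_powser:
  assumes "bilateral_sums (\<lambda>n. w powi n * a n) s"
  shows "summable (\<lambda>n. w ^ n * a (int n))"
    and "summable (\<lambda>n. inverse w ^ n * principal_coeff a n)"
    and "s = (\<Sum>n. w ^ n * a (int n)) + (\<Sum>n. inverse w ^ n * principal_coeff a n)"
proof -
  obtain s1 s2 where s1: "(\<lambda>n. w powi int n * a (int n)) sums s1"
    and s2: "(\<lambda>n. w powi (- int (Suc n)) * a (- int (Suc n))) sums s2" and s: "s = s1 + s2"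
    using assms unfolding bilateral_sums_def by blast
  have 1: "(\<lambda>n. w ^ n * a (int n)) sums s1"
    using s1 by simp
  have "(\<lambda>n. inverse w ^ Suc n * principal_coeff a (Suc n)) sums s2"
    using s2 by (simp only: principal_coeff_def power_int_minus power_int_of_nat power_inverse
        nat.distinct if_False)
  then have 2: "(\<lambda>n. inverse w ^ n * principal_coeff a n) sums s2"
    by (subst (asm) sums_Suc_iff) (simp add: principal_coeff_def)
  show "summable (\<lambda>n. w ^ n * a (int n))"
    "summable (\<lambda>n. inverse w ^ n * principal_coeff a n)"
    "s = (\<Sum>n. w ^ n * a (int n)) + (\<Sum>n. inverse w ^ n * principal_coeff a n)"
    using 1 2 s by (auto simp: sums_iff)
qed

context
  fixes a :: "int \<Rightarrow> quat" and f :: "quat \<Rightarrow> quat" and q0 :: quat and R1 R2 :: real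
  assumes R1: "R1 > 0"
    and series: "\<And>q. R1 \<le> norm (q - q0) \<Longrightarrow> norm (q - q0) \<le> R2 \<Longrightarrow>
           bilateral_sums (\<lambda>n. (q - q0) powi n * a n) (f q)"
begin

text \<open>
  Convergence at one point of each boundary sphere is all that the power series results need: the
  outer sphere serves the regular part, the inner sphere the principal part.
\<close>

lemma regular_part_summable:
  assumes "R1 \<le> R2"
  shows "summable (\<lambda>n. of_real R2 ^ n * a (int n))"
  using bilateral_sums_imp_powser(1)[OF series[of "q0 + of_real R2"]] R1 assms by simp

lemma principal_part_summable:
  assumes "R1 \<le> R2"
  shows "summable (\<lambda>n. of_real (inverse R1) ^ n * principal_coeff a n)"
  using bilateral_sums_imp_powser(2)[OF series[of "q0 + of_real R1"]] R1 assms by simp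

lemma norm_inverse_less:
  fixes w :: quat
  assumes "R1 < norm w"
  shows "norm (inverse w) < inverse R1"
  unfolding norm_inverse using assms R1 by (rule less_imp_inverse_less)

lemma has_derivative_laurent:
  assumes "R1 < norm (q - q0)" and "norm (q - q0) < R2"
  shows "(f has_derivative laurent_frechet a (q - q0)) (at q)"
proof -
  let ?A = "\<lambda>u. \<Sum>n. u ^ n * a (int n)"
  let ?B = "\<lambda>u. \<Sum>n. u ^ n * principal_coeff a n"
  have le: "R1 \<le> R2" using assms by simp
  have nz: "q - q0 \<noteq> 0" using assms R1 by auto
  have shift: "((\<lambda>q. q - q0) has_derivative (\<lambda>h. h)) (at q)"
    by (auto intro!: derivative_eq_intros)
  have "((\<lambda>q. ?A (q - q0)) has_derivative powser_deriv (\<lambda>n. a (int n)) (q - q0)) (at q)"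
    using has_derivative_compose[OF shift
        has_derivative_powser[OF regular_part_summable[OF le] assms(2)]] .
  moreover have "((\<lambda>q. ?B (inverse (q - q0))) has_derivative
      (\<lambda>h. powser_deriv (principal_coeff a) (inverse (q - q0))
         (- (inverse (q - q0) * h * inverse (q - q0))))) (at q)"
    using has_derivative_compose[OF Deriv.has_derivative_inverse[OF nz shift]
        has_derivative_powser[OF principal_part_summable[OF le] norm_inverse_less[OF assms(1)]]] .
  ultimately have "((\<lambda>q. ?A (q - q0) + ?B (inverse (q - q0))) has_derivative
      laurent_frechet a (q - q0)) (at q)"
    unfolding laurent_frechet_def[abs_def] by (rule has_derivative_add)
  then show ?thesis
  proof (rule has_derivative_transform_within_open)
    show "open {q. R1 < norm (q - q0) \<and> norm (q - q0) < R2}"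
      by (intro open_Collect_conj open_Collect_less continuous_intros)
  qed (use assms in \<open>auto simp: bilateral_sums_imp_powser(3)[OF series]\<close>)
qed

lemma tendsto_laurent_frechet:
  assumes "R1 < norm w" and "norm w < R2"
  shows "((\<lambda>w. laurent_frechet a w h) \<longlongrightarrow> laurent_frechet a w h) (at w)"
proof -
  have le: "R1 \<le> R2" using assms by simp
  have inv: "(inverse \<longlongrightarrow> inverse w) (at w)"
    using assms R1 by (intro tendsto_inverse tendsto_ident_at) auto
  show ?thesis
    unfolding laurent_frechet_def
    by (intro tendsto_add tendsto_powser_deriv[OF regular_part_summable[OF le] assms(2)]
        tendsto_powser_deriv[OF principal_part_summable[OF le] norm_inverse_less[OF assms(1)]]
        inv tendsto_ident_at tendsto_const tendsto_minus tendsto_mult)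
qed

text \<open>
  If \<open>h\<close> commutes with \<open>w = q - q0\<close>, it also commutes with \<open>v = inverse w\<close>, and so does the inner
  direction \<open>- v h v\<close>. Hence the derivatives of \<open>w\<^sup>n\<close> and of \<open>v\<^sup>n\<close> collapse to \<open>h n w\<^sup>n\<^sup>-\<^sup>1\<close> and
  \<open>- h n w\<^sup>-\<^sup>n\<^sup>-\<^sup>1\<close>, which are the formal derivatives multiplied by \<open>h\<close> from the left.
\<close>

lemma bilateral_sums_laurent_frechet_commuting:
  assumes "R1 < norm (q - q0)" and "norm (q - q0) < R2" and comm: "(q - q0) * h = h * (q - q0)"
  shows "bilateral_sums (\<lambda>n. h * laurent_deriv_term a q0 q n) (laurent_frechet a (q - q0) h)"
proof -
  define w where "w = q - q0"
  define v where "v = inverse w"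
  have le: "R1 \<le> R2" using assms by simp
  have nz: "w \<noteq> 0" using assms R1 by (auto simp: w_def)
  have vh: "v * h = h * v"
  proof -
    have "v * h = v * (h * w) * v"
      using nz by (simp add: v_def mult.assoc)
    also have "\<dots> = v * (w * h) * v"
      using comm by (simp add: w_def)
    also have "\<dots> = h * v"
      using nz by (simp add: v_def flip: mult.assoc)
    finally show ?thesis .
  qed
  have comm_nat: "of_nat n * (h * x) = h * (of_nat n * x)" for n x
    by (metis mult.assoc mult_of_nat_commute)
  have "power_deriv n w h * a (int n) = h * laurent_deriv_term a q0 q (int n)" for n
  proof (cases n)
    case (Suc m)
    have "w powi (int (Suc m) - 1) = w ^ m" by simp
    moreover have "power_deriv (Suc m) w h = of_nat (Suc m) * (h * w ^ m)"
      using power_deriv_commuting[of w h "Suc m"] comm by (simp add: w_def)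
    ultimately show ?thesis
      by (simp only: Suc laurent_deriv_term_def of_int_of_nat_eq mult.assoc comm_nat flip: w_def)
  qed (simp add: power_deriv_def laurent_deriv_term_def)
  then have 1: "(\<lambda>n. h * laurent_deriv_term a q0 q (int n)) sums
      powser_deriv (\<lambda>n. a (int n)) w h"
    using powser_deriv_sums[OF regular_part_summable[OF le], of w h] assms by (simp add: w_def)
  have principal_term: "power_deriv (Suc n) v (- (v * h * v)) * principal_coeff a (Suc n)
      = h * laurent_deriv_term a q0 q (- int (Suc n))" for n
  proof -
    have "v * (- (v * h * v)) = (- (v * h * v)) * v"
      by (metis mult.assoc vh mult_minus_left mult_minus_right)
    then have "power_deriv (Suc n) v (- (v * h * v)) = - (of_nat (Suc n) * (v * h * v * v ^ n))"
      by (simp add: power_deriv_commuting)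
    also have "\<dots> = - (h * (of_nat (Suc n) * v ^ Suc (Suc n)))"
      using comm_nat[of "Suc n"] by (simp add: vh mult.assoc del: of_nat_Suc)
    also have "v ^ Suc (Suc n) = w powi (- int (Suc n) - 1)"
    proof -
      have "- int (Suc n) - 1 = - int (Suc (Suc n))" by simp
      then show ?thesis
        by (simp only: v_def power_int_minus power_int_of_nat power_inverse)
    qed
    finally have "power_deriv (Suc n) v (- (v * h * v)) =
        h * (of_int (- int (Suc n)) * w powi (- int (Suc n) - 1))"
      by (simp only: of_int_minus of_int_of_nat_eq mult_minus_left mult_minus_right)
    then show ?thesis
      by (simp only: laurent_deriv_term_def principal_coeff_def mult.assoc w_def nat.distinct
          if_False)
  qed
  have "(\<lambda>n. power_deriv n v (- (v * h * v)) * principal_coeff a n) sums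
      powser_deriv (principal_coeff a) v (- (v * h * v))"
    using powser_deriv_sums[OF principal_part_summable[OF le] norm_inverse_less] assms
    by (simp add: w_def v_def)
  then have 2: "(\<lambda>n. h * laurent_deriv_term a q0 q (- int (Suc n))) sums
      powser_deriv (principal_coeff a) v (- (v * h * v))"
    unfolding principal_term[symmetric] by (subst sums_Suc_iff) (simp add: power_deriv_def)
  show ?thesis
    using 1 2 unfolding bilateral_sums_def laurent_frechet_def v_def w_def by blast
qed

lemma laurent_deriv_sums:
  assumes "R1 < norm (q - q0)" and "norm (q - q0) < R2"
  shows "bilateral_sums (laurent_deriv_term a q0 q) (laurent_frechet a (q - q0) 1)"
  using bilateral_sums_laurent_frechet_commuting[OF assms, of 1] by simp

lemma laurent_deriv_eq:
  assumes "R1 < norm (q - q0)" and "norm (q - q0) < R2"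
  shows "laurent_deriv a q0 q = laurent_frechet a (q - q0) 1"
  unfolding laurent_deriv_def by (rule bilateral_suminf_eqI[OF laurent_deriv_sums[OF assms]])

lemma laurent_frechet_commuting:
  assumes "R1 < norm (q - q0)" and "norm (q - q0) < R2" and "(q - q0) * h = h * (q - q0)"
  shows "laurent_frechet a (q - q0) h = h * laurent_deriv a q0 q"
proof -
  have "bilateral_sums (\<lambda>n. h * laurent_deriv_term a q0 q n) (h * laurent_deriv a q0 q)"
    using laurent_deriv_sums[OF assms(1,2)]
    unfolding laurent_deriv_eq[OF assms(1,2)] bilateral_sums_def
    by (metis sums_mult distrib_left)
  with bilateral_sums_laurent_frechet_commuting[OF assms] show ?thesis
    by (metis bilateral_suminf_eqI)
qed

text \<open>
  Near \<open>x\<close> the right HR derivative is a fixed linear combination of values of the real derivative in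
  the four unit directions, so its limit can be computed at \<open>x\<close> itself. There every direction
  commutes with the real number \<open>x - q0\<close>.
\<close>

lemma tendsto_right_HR_deriv:
  assumes "R1 < norm (of_real x - q0)" and "norm (of_real x - q0) < R2" and "q0 \<in> \<real>"
  shows "(right_HR_deriv f \<longlongrightarrow> laurent_deriv a q0 (of_real x)) (at (of_real x))"
    and "(laurent_deriv a q0 \<longlongrightarrow> laurent_deriv a q0 (of_real x)) (at (of_real x))"
proof -
  let ?D = "\<lambda>q. laurent_frechet a (q - q0)"
  let ?L = "laurent_deriv a q0 (of_real x)"
  define A where "A = {q. R1 < norm (q - q0) \<and> norm (q - q0) < R2}"
  have "open A"
    unfolding A_def by (intro open_Collect_conj open_Collect_less continuous_intros)
  then have near: "\<forall>\<^sub>F q in at (of_real x). q \<in> A"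
    using assms by (intro eventually_at_in_open') (auto simp: A_def)
  have lim: "((\<lambda>q. ?D q h) \<longlongrightarrow> ?D (of_real x) h) (at (of_real x))" for h
  proof -
    have "isCont (\<lambda>w. laurent_frechet a w h) (of_real x - q0)"
      unfolding isCont_def by (rule tendsto_laurent_frechet[OF assms(1,2)])
    moreover have "((\<lambda>q. q - q0) \<longlongrightarrow> of_real x - q0) (at (of_real x))"
      by (intro tendsto_intros)
    ultimately show ?thesis by (rule isCont_tendsto_compose)
  qed
  have D: "?D (of_real x) h = h * ?L" for h
  proof (rule laurent_frechet_commuting[OF assms(1,2)])
    obtain y where "of_real x - q0 = of_real y"
      using assms(3) by (metis Reals_cases of_real_diff)
    then show "(of_real x - q0) * h = h * (of_real x - q0)"
      by (simp add: of_real_def)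
  qed
  have "((\<lambda>q. (1/4) *\<^sub>R (?D q 1 - qi * ?D q qi - qj * ?D q qj - qk * ?D q qk)) \<longlongrightarrow>
      (1/4) *\<^sub>R (1 * ?L - qi * (qi * ?L) - qj * (qj * ?L) - qk * (qk * ?L))) (at (of_real x))"
    unfolding D[symmetric] by (intro tendsto_intros lim)
  also have "(1/4) *\<^sub>R (1 * ?L - qi * (qi * ?L) - qj * (qj * ?L) - qk * (qk * ?L)) = ?L"
    by (simp add: quat_units_mult scaleR_2[symmetric] flip: mult.assoc)
       (simp add: algebra_simps flip: scaleR_left.add)
  finally show "(right_HR_deriv f \<longlongrightarrow> ?L) (at (of_real x))"
    by (rule Lim_transform_eventually) (use near in eventually_elim,
        simp add: A_def right_HR_deriv_eq[OF has_derivative_laurent])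
  have "((\<lambda>q. ?D q 1) \<longlongrightarrow> ?L) (at (of_real x))"
    using lim[of 1] D[of 1] by simp
  then show "(laurent_deriv a q0 \<longlongrightarrow> ?L) (at (of_real x))"
    by (rule Lim_transform_eventually) (use near in eventually_elim,
        simp add: A_def laurent_deriv_eq)
qed

end

theorem theorem5:
  fixes f :: "quat \<Rightarrow> quat" and a :: "int \<Rightarrow> quat" and q0 :: quat and R1 R2 :: real
  assumes "R1 > 0" and "R2 > 0"
    and "\<And>q. R1 \<le> norm (q - q0) \<Longrightarrow> norm (q - q0) \<le> R2 \<Longrightarrow>
           bilateral_sums (\<lambda>n. (q - q0) powi n * a n) (f q)"
    and "q0 \<in> \<real>"
  shows "(\<forall>q. R1 < norm (q - q0) \<and> norm (q - q0) < R2 \<longrightarrow>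
            has_partials_at f q \<and> bilateral_summable (laurent_deriv_term a q0 q)) \<and>
         (\<forall>x::real. R1 < norm (of_real x - q0) \<and> norm (of_real x - q0) < R2 \<longrightarrow>
            (right_HR_deriv f \<longlongrightarrow> laurent_deriv a q0 (of_real x)) (at (of_real x)) \<and>
            ((\<lambda>q. right_HR_deriv f q - laurent_deriv a q0 q) \<longlongrightarrow> 0) (at (of_real x)))"
proof (intro conjI allI impI; elim conjE)
  note lau = assms(1,3)
  fix q assume q: "R1 < norm (q - q0)" "norm (q - q0) < R2"
  show "has_partials_at f q"
    by (rule has_derivative_imp_has_partials_at[OF has_derivative_laurent[OF lau q]])
  show "bilateral_summable (laurent_deriv_term a q0 q)"
    unfolding bilateral_summable_def using laurent_deriv_sums[OF lau q] by blast
next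
  fix x :: real assume x: "R1 < norm (of_real x - q0)" "norm (of_real x - q0) < R2"
  note lim = tendsto_right_HR_deriv[OF assms(1,3) x assms(4)]
  show "(right_HR_deriv f \<longlongrightarrow> laurent_deriv a q0 (of_real x)) (at (of_real x))"
    by (rule lim(1))
  show "((\<lambda>q. right_HR_deriv f q - laurent_deriv a q0 q) \<longlongrightarrow> 0) (at (of_real x))"
    using tendsto_diff[OF lim] by simp
qed

end
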